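(* Let $\alpha=(\alpha_n)_{n\in\mathbb{N}}$ be a non-negative increasing sequence with $\lim_{n\to\infty}\alpha_n=\infty$ such that $\Lambda_\infty(\alpha)$ is nuclear, and let $\beta\in(\Lambda_\infty(\alpha))'$. Then: (i) The dual convolution operator $\check{T}_\beta:\Lambda_\infty(\alpha)\to\Lambda_\infty(\alpha)$ is m-topologizable if and only if for every $p\in\mathbb{N}$ there exist $q\in\mathbb{N}$ and $D_p>0$ such that $|\beta^{*k}_{n-1}|\le D_p^k e^{q\alpha_n}$ for every $k,n\in\mathbb{N}$. (ii) $\check{T}_\beta:\Lambda_\infty(\alpha)\to\Lambda_\infty(\alpha)$ is power bounded if and only if for every $p\in\mathbb{N}$ there exist $q\in\mathbb{N}$ and $C_p\ge1$ such that $|\beta^{*k}_{n-1}|\le C_p e^{q\alpha_n}$ for every $k,n\in\mathbb{N}$.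
   Context: $\mathbb{N}=\{1,2,\dots\}$, $\mathbb{N}_0=\mathbb{N}\cup\{0\}$. The power series space of infinite type is $\Lambda_\infty(\alpha)=\{x=(x_n)_{n\in\mathbb{N}}:\|x\|_k:=\sum_{n=1}^\infty|x_n|e^{k\alpha_n}<\infty\text{ for all }k\in\mathbb{N}\}$, a Fréchet space with the increasing sequence of seminorms $(\|\cdot\|_k)_{k\in\mathbb{N}}$ and canonical basis $(e_n)_{n\in\mathbb{N}}$. It is nuclear if and only if $\sup_{n}\frac{\ln n}{\alpha_n}<\infty$. Its dual is identified with the sequences $\beta=(\beta_n)_{n\in\mathbb{N}_0}$ (indexed from $0$, $\beta_{n-1}$ being the $n$-th coordinate) such that for some $m\in\mathbb{N}$, $C>0$: $|\beta_{n-1}|\le Ce^{m\alpha_n}$ for all $n\in\mathbb{N}$. The dual convolution operator $\check{T}_\beta$ is the continuous linear operator on $\Lambda_\infty(\alpha)$ with $\check{T}_\beta e_n=\sum_{j=1}^n\beta_{n-j}e_j$ and $\check{T}_\beta x=\sum_{n=1}^\infty x_n\check{T}_\beta e_n$ (well-defined and continuous for every $\beta\in(\Lambda_\infty(\alpha))'$ when $\Lambda_\infty(\alpha)$ is nuclear). Convolution of sequences indexed by $\mathbb{N}_0$: $(\beta*\psi)_m=\sum_{i=0}^m\beta_i\psi_{m-i}$; $\beta^{*k}=\beta*\cdots*\beta$ ($k$ factors), and $\beta^{*k}_{m}$ is its entry of index $m\in\mathbb{N}_0$. A continuous linear operator $T$ on a Fréchet space $E$ with increasing seminorms $(\|\cdot\|_p)_{p\in\mathbb{N}}$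 is m-topologizable if for every $p\in\mathbb{N}$ there exist $q\in\mathbb{N}$ and $C_p\ge1$ with $\|T^kx\|_p\le C_p^k\|x\|_q$ for all $k\in\mathbb{N}$, $x\in E$; it is power bounded if for every $p\in\mathbb{N}$ there exist $q\in\mathbb{N}$ and $C_p\ge1$ with $\|T^kx\|_p\le C_p\|x\|_q$ for all $k\in\mathbb{N}$, $x\in E$. *)

theory Defs
  imports "HOL-Analysis.Analysis"
begin

text \<open>
  Sequences indexed by \<open>{1, 2, \<dots>}\<close> are shifted by one: \<open>\<alpha> n\<close>, \<open>x n\<close> and \<open>unit_seq n\<close>
  (\<open>n :: nat\<close>) stand for \<open>\<alpha>\<^sub>n\<^sub>+\<^sub>1\<close>, \<open>x\<^sub>n\<^sub>+\<^sub>1\<close> and \<open>e\<^sub>n\<^sub>+\<^sub>1\<close>. Sequences \<open>\<beta>\<close> indexed by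
  \<open>{0, 1, \<dots>}\<close> are not shifted, so an inequality between \<open>\<beta>\<^sub>n\<^sub>-\<^sub>1\<close> and \<open>\<alpha>\<^sub>n\<close> reads
  \<open>\<beta> n\<close> and \<open>\<alpha> n\<close> here. Seminorms and iterates are not shifted; their indices range over
  \<open>{1, 2, \<dots>}\<close> by explicit guards. The sort \<open>{real_normed_field, banach}\<close> covers both
  real and complex scalars.
\<close>

definition psnorm :: "(nat \<Rightarrow> real) \<Rightarrow> nat \<Rightarrow> (nat \<Rightarrow> 'a::{real_normed_field, banach}) \<Rightarrow> real" where
  "psnorm \<alpha> k x = (\<Sum>n. norm (x n) * exp (real k * \<alpha> n))"

definition power_series_space :: "(nat \<Rightarrow> real) \<Rightarrow> (nat \<Rightarrow> 'a::{real_normed_field, banach}) set" where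
  "power_series_space \<alpha> = {x. \<forall>k\<ge>1. summable (\<lambda>n. norm (x n) * exp (real k * \<alpha> n))}"

definition power_series_dual :: "(nat \<Rightarrow> real) \<Rightarrow> (nat \<Rightarrow> 'a::{real_normed_field, banach}) set" where
  "power_series_dual \<alpha> =
     {\<beta>. \<exists>m\<ge>1. \<exists>C>0. \<forall>n. norm (\<beta> n) \<le> C * exp (real (m::nat) * \<alpha> n)}"

text \<open>
  The following notions concern a linear space \<open>E\<close> of scalar sequences with an increasing
  sequence of seminorms \<open>P 1, P 2, \<dots>\<close>.
\<close>

definition linear_functional_on ::
  "(nat \<Rightarrow> 'a::{real_normed_field, banach}) set \<Rightarrow> ((nat \<Rightarrow> 'a) \<Rightarrow> 'a) \<Rightarrow> bool" where
  "linear_functional_on E f \<longleftrightarrow>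
     (\<forall>x\<in>E. \<forall>y\<in>E. \<forall>a b. f (\<lambda>n. a * x n + b * y n) = a * f x + b * f y)"

text \<open>
  Nuclearity in the sense of Pietsch: for every \<open>p\<close> there is \<open>q \<ge> p\<close> such that the canonical
  map from \<open>E / ker (P q)\<close> to \<open>E / ker (P p)\<close> is nuclear, i.e. has the form
  \<open>x \<mapsto> \<Sum>i. f i x * y i\<close> with the sum over \<open>i\<close> of \<open>\<parallel>f i\<parallel>\<^sub>q * \<parallel>y i\<parallel>\<^sub>p\<close> finite. The
  number \<open>c i\<close> is an upper bound of the dual norm of \<open>f i\<close>. Passing to the completions of the
  quotients gives the same notion, as an element of the completion is the sum of an absolutely
  convergent series in \<open>E / ker (P p)\<close> whose norms add up to at most twice its norm.
\<close>

definition nuclear_space ::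
  "(nat \<Rightarrow> 'a::{real_normed_field, banach}) set \<Rightarrow> (nat \<Rightarrow> (nat \<Rightarrow> 'a) \<Rightarrow> real) \<Rightarrow> bool" where
  "nuclear_space E P \<longleftrightarrow>
     (\<forall>p\<ge>1. \<exists>q\<ge>p. \<exists>(f :: nat \<Rightarrow> (nat \<Rightarrow> 'a) \<Rightarrow> 'a) (c :: nat \<Rightarrow> real) (y :: nat \<Rightarrow> nat \<Rightarrow> 'a).
        (\<forall>i. linear_functional_on E (f i)) \<and>
        (\<forall>i. 0 \<le> c i \<and> (\<forall>x\<in>E. norm (f i x) \<le> c i * P q x)) \<and>
        (\<forall>i. y i \<in> E) \<and>
        summable (\<lambda>i. c i * P p (y i)) \<and>
        (\<forall>x\<in>E. (\<lambda>N. P p (\<lambda>n. x n - (\<Sum>i<N. f i x * y i n))) \<longlonglongrightarrow> 0))"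

definition continuous_linear_operator ::
  "(nat \<Rightarrow> 'a::{real_normed_field, banach}) set \<Rightarrow> (nat \<Rightarrow> (nat \<Rightarrow> 'a) \<Rightarrow> real) \<Rightarrow>
   ((nat \<Rightarrow> 'a) \<Rightarrow> (nat \<Rightarrow> 'a)) \<Rightarrow> bool" where
  "continuous_linear_operator E P T \<longleftrightarrow>
     (\<forall>x\<in>E. T x \<in> E) \<and>
     (\<forall>x\<in>E. \<forall>y\<in>E. \<forall>a b. T (\<lambda>n. a * x n + b * y n) = (\<lambda>n. a * T x n + b * T y n)) \<and>
     (\<forall>p\<ge>1. \<exists>q\<ge>1. \<exists>C. \<forall>x\<in>E. P p (T x) \<le> C * P q x)"

definition m_topologizable ::
  "(nat \<Rightarrow> 'a::{real_normed_field, banach}) set \<Rightarrow> (nat \<Rightarrow> (nat \<Rightarrow> 'a) \<Rightarrow> real) \<Rightarrow>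
   ((nat \<Rightarrow> 'a) \<Rightarrow> (nat \<Rightarrow> 'a)) \<Rightarrow> bool" where
  "m_topologizable E P T \<longleftrightarrow>
     continuous_linear_operator E P T \<and>
     (\<forall>p\<ge>1. \<exists>q\<ge>1. \<exists>C\<ge>1. \<forall>k\<ge>1. \<forall>x\<in>E. P p ((T ^^ k) x) \<le> C ^ k * P q x)"

definition power_bounded ::
  "(nat \<Rightarrow> 'a::{real_normed_field, banach}) set \<Rightarrow> (nat \<Rightarrow> (nat \<Rightarrow> 'a) \<Rightarrow> real) \<Rightarrow>
   ((nat \<Rightarrow> 'a) \<Rightarrow> (nat \<Rightarrow> 'a)) \<Rightarrow> bool" where
  "power_bounded E P T \<longleftrightarrow>
     continuous_linear_operator E P T \<and>
     (\<forall>p\<ge>1. \<exists>q\<ge>1. \<exists>C\<ge>1. \<forall>k\<ge>1. \<forall>x\<in>E. P p ((T ^^ k) x) \<le> C * P q x)"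

definition unit_seq :: "nat \<Rightarrow> nat \<Rightarrow> 'a::{real_normed_field, banach}" where
  "unit_seq n = (\<lambda>i. if i = n then 1 else 0)"

definition dual_conv_unit ::
  "(nat \<Rightarrow> 'a::{real_normed_field, banach}) \<Rightarrow> nat \<Rightarrow> nat \<Rightarrow> 'a" where
  "dual_conv_unit \<beta> n = (\<lambda>i. \<Sum>j\<le>n. \<beta> (n - j) * unit_seq j i)"

text \<open>
  The series over \<open>n\<close> of \<open>x n * dual_conv_unit \<beta> n\<close> is evaluated coordinatewise; coordinates
  are continuous on the power series space, so this is the sum in its topology whenever the
  series converges there.
\<close>

definition dual_conv ::
  "(nat \<Rightarrow> 'a::{real_normed_field, banach}) \<Rightarrow> (nat \<Rightarrow> 'a) \<Rightarrow> nat \<Rightarrow> 'a" where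
  "dual_conv \<beta> x = (\<lambda>i. \<Sum>n. x n * dual_conv_unit \<beta> n i)"

lemma dual_conv_unit_seq: "dual_conv \<beta> (unit_seq n) = dual_conv_unit \<beta> n"
proof
  fix i
  have "(\<lambda>m. unit_seq n m * dual_conv_unit \<beta> m i) = (\<lambda>m. if m = n then dual_conv_unit \<beta> m i else 0)"
    by (auto simp: unit_seq_def)
  then show "dual_conv \<beta> (unit_seq n) i = dual_conv_unit \<beta> n i"
    unfolding dual_conv_def using sums_single[of n "\<lambda>m. dual_conv_unit \<beta> m i"]
    by (simp add: sums_iff)
qed

definition seq_conv ::
  "(nat \<Rightarrow> 'a::{real_normed_field, banach}) \<Rightarrow> (nat \<Rightarrow> 'a) \<Rightarrow> nat \<Rightarrow> 'a" where
  "seq_conv \<beta> \<psi> = (\<lambda>m. \<Sum>i\<le>m. \<beta> i * \<psi> (m - i))"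

primrec conv_power :: "(nat \<Rightarrow> 'a::{real_normed_field, banach}) \<Rightarrow> nat \<Rightarrow> nat \<Rightarrow> 'a" where
  "conv_power \<beta> 0 = unit_seq 0"
| "conv_power \<beta> (Suc k) = seq_conv \<beta> (conv_power \<beta> k)"

lemma conv_power_1: "conv_power \<beta> 1 = \<beta>"
proof
  fix m
  have "(\<Sum>i\<le>m. \<beta> i * unit_seq 0 (m - i)) = (\<Sum>i\<le>m. if i = m then \<beta> i else 0)"
    by (rule sum.cong) (auto simp: unit_seq_def)
  then show "conv_power \<beta> 1 m = \<beta> m"
    by (simp add: seq_conv_def)
qed

end

theory Submission
  imports Defs
begin

text \<open>
  Write \<open>E\<close> for the power series space and \<open>T \<beta>\<close> for \<^term>\<open>dual_conv \<beta>\<close>, so that \<open>T \<beta>\<close> sends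
  the unit vector \<open>e n\<close> to the vector with entries \<open>\<beta> (n - i)\<close> for \<open>i \<le> n\<close>. The theorem says that
  the growth of the iterates of \<open>T \<beta>\<close> can be read off from the growth of the convolution powers of
  \<open>\<beta>\<close>, and it holds for two reasons.

  First, \<open>\<beta> \<mapsto> T \<beta>\<close> turns convolution into composition (\<open>dual_conv_dual_conv\<close>), so the \<open>k\<close>-th
  iterate of \<open>T \<beta>\<close> is again a dual convolution operator, with symbol the \<open>k\<close>-th convolution power
  (\<open>funpow_dual_conv\<close>).

  Second, the size of a symbol \<open>\<phi>\<close> and the size of \<open>T \<phi>\<close> control each other, with constants
  that do not depend on \<open>\<phi>\<close>. The entry of \<open>T \<phi> (e n)\<close> with index \<open>0\<close> is \<open>\<phi> n\<close>, so bounds on the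
  operator restrict to bounds on the symbol. Conversely, if \<open>\<phi> n\<close> is at most
  \<open>B * exp (q * \<alpha> n)\<close> in norm, then each of the \<open>n + 1\<close> entries of \<open>T \<phi> (e n)\<close> contributes at most
  \<open>B * exp ((p + q) * \<alpha> n)\<close> to the \<open>p\<close>-th seminorm, because \<open>\<alpha>\<close> is increasing. Nuclearity is what
  absorbs the number of entries: it yields \<open>n + 1 \<le> M * exp (r * \<alpha> n)\<close>
  (\<open>nuclear_imp_exponential_growth\<close>). Hence passing from the symbol to the operator only costs the
  factor \<open>M\<close> and a shift of the seminorm index (\<open>dual_conv_bound\<close>). Applied to the
  \<open>k\<close>-th convolution power, the factor \<open>M\<close> is harmless both next to a bound \<open>D ^ k\<close> with \<open>k \<ge> 1\<close>
  and next to a bound independent of \<open>k\<close>.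
\<close>

section \<open>Triangular double series\<close>

text \<open>
  The form of Fubini's theorem behind both the composition rule and the operator bound: row \<open>n\<close>
  has at most \<open>n + 1\<close> nonzero entries, all bounded by \<open>c n\<close>, so \<open>(n + 1) * c n\<close> majorises the
  absolute row sum.
\<close>

lemma triangular_sum_swap:
  fixes a :: "nat \<Rightarrow> nat \<Rightarrow> 'b::banach"
  assumes tri: "\<And>n i. n < i \<Longrightarrow> a n i = 0"
    and bd: "\<And>n i. i \<le> n \<Longrightarrow> norm (a n i) \<le> c n"
    and c: "summable (\<lambda>n. (real n + 1) * c n)"
  shows "\<And>i. summable (\<lambda>n. norm (a n i))"
    and "summable (\<lambda>i. \<Sum>n. norm (a n i))"
    and "(\<Sum>i. \<Sum>n. norm (a n i)) \<le> (\<Sum>n. (real n + 1) * c n)"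
    and "(\<Sum>i. \<Sum>n. a n i) = (\<Sum>n. \<Sum>i\<le>n. a n i)"
proof -
  have inf_eq: "infsum f UNIV = suminf f"
    if "summable (\<lambda>n. norm (f n))" for f :: "nat \<Rightarrow> 'c::banach"
    by (rule infsumI, rule norm_summable_imp_has_sum[OF that])
       (rule summable_sums[OF summable_norm_cancel[OF that]])
  have row_sums: "(\<lambda>i. norm (a n i)) sums (\<Sum>i\<le>n. norm (a n i))" for n
    by (rule sums_finite) (auto intro: tri)
  have row_sums': "(\<lambda>i. a n i) sums (\<Sum>i\<le>n. a n i)" for n
    by (rule sums_finite) (auto intro: tri)
  have row_le: "(\<Sum>i\<le>n. norm (a n i)) \<le> (real n + 1) * c n" for n
    using sum_bounded_above[of "{..n}" "\<lambda>i. norm (a n i)" "c n"] bd by (simp add: algebra_simps)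
  have row: "summable (\<lambda>i. norm (a n i))" and row_eq: "(\<Sum>i. norm (a n i)) = (\<Sum>i\<le>n. norm (a n i))" for n
    using row_sums[of n] by (auto simp: sums_iff)
  have row_inf: "(\<Sum>\<^sub>\<infinity>i. norm (a n i)) = (\<Sum>i\<le>n. norm (a n i))" for n
    using inf_eq[of "\<lambda>i. norm (a n i)"] row[of n] row_eq[of n] by simp
  have total: "summable (\<lambda>n. \<Sum>i\<le>n. norm (a n i))"
    by (rule summable_comparison_test'[OF c, of 0]) (use row_le in \<open>simp add: sum_nonneg\<close>)
  have "(\<lambda>z. norm (case_prod a z)) summable_on (UNIV \<times> UNIV)"
  proof (rule iffD2[OF Infinite_Sum.abs_summable_on_Sigma_iff], intro conjI ballI)
    fix n
    show "(\<lambda>i. norm (case_prod a (n, i))) summable_on UNIV"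
      using row[of n] by (auto intro!: norm_summable_imp_summable_on)
  next
    show "(\<lambda>n. norm (\<Sum>\<^sub>\<infinity>i. norm (case_prod a (n, i)))) summable_on UNIV"
      using total row_inf by (auto intro!: norm_summable_imp_summable_on simp: sum_nonneg)
  qed
  then have abs: "(\<lambda>(n, i). norm (a n i)) summable_on (UNIV \<times> UNIV)"
    by (simp add: case_prod_unfold)
  then have sm: "(\<lambda>(n, i). a n i) summable_on (UNIV \<times> UNIV)"
    using abs_summable_summable[of "\<lambda>(n, i). a n i" "UNIV \<times> UNIV"] by (simp add: case_prod_unfold)
  have "(\<lambda>(i, n). norm (a n i)) summable_on (UNIV \<times> UNIV)"
    using abs summable_on_swap[of "\<lambda>(n, i). norm (a n i)" UNIV UNIV] by (simp add: case_prod_unfold)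
  then have "(\<lambda>z. norm ((\<lambda>(i, n). a n i) z)) summable_on (UNIV \<times> UNIV)"
    by (simp add: case_prod_unfold)
  then have col0: "\<And>i. (\<lambda>n. norm (a n i)) summable_on UNIV"
    and colsum0: "(\<lambda>i. norm (\<Sum>\<^sub>\<infinity>n. norm (a n i))) summable_on UNIV"
    using Infinite_Sum.abs_summable_on_Sigma_iff[of "\<lambda>(i, n). a n i" UNIV "\<lambda>_. UNIV"] by auto
  show col: "summable (\<lambda>n. norm (a n i))" for i
    using summable_on_imp_summable[OF col0] .
  have col_eq: "(\<Sum>\<^sub>\<infinity>n. norm (a n i)) = (\<Sum>n. norm (a n i))" for i
    by (rule inf_eq) (simp add: col)
  have pos: "0 \<le> (\<Sum>n. norm (a n i))" for i
    by (simp add: suminf_nonneg col)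
  show colsum: "summable (\<lambda>i. \<Sum>n. norm (a n i))"
    using summable_on_imp_summable[OF colsum0] pos by (simp add: col_eq)
  have "(\<Sum>i. \<Sum>n. norm (a n i)) = (\<Sum>\<^sub>\<infinity>i. \<Sum>\<^sub>\<infinity>n. norm (a n i))"
    unfolding col_eq by (rule inf_eq[symmetric]) (use colsum pos in simp)
  also have "\<dots> = (\<Sum>\<^sub>\<infinity>n. \<Sum>\<^sub>\<infinity>i. norm (a n i))"
    by (rule infsum_swap_banach[symmetric, OF abs])
  also have "\<dots> = (\<Sum>\<^sub>\<infinity>n. \<Sum>i\<le>n. norm (a n i))"
    by (simp only: row_inf)
  also have "\<dots> = (\<Sum>n. \<Sum>i\<le>n. norm (a n i))"
    by (rule inf_eq) (use total in \<open>simp add: sum_nonneg\<close>)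
  also have "\<dots> \<le> (\<Sum>n. (real n + 1) * c n)"
    by (rule suminf_le[OF row_le total c])
  finally show "(\<Sum>i. \<Sum>n. norm (a n i)) \<le> (\<Sum>n. (real n + 1) * c n)" .
  have coleq': "(\<Sum>\<^sub>\<infinity>n. a n i) = (\<Sum>n. a n i)" for i
    by (rule inf_eq[OF col])
  have roweq': "(\<Sum>\<^sub>\<infinity>i. a n i) = (\<Sum>i\<le>n. a n i)" for n
    using inf_eq[OF row] row_sums'[of n] by (simp add: sums_iff)
  have "(\<Sum>i. \<Sum>n. a n i) = (\<Sum>\<^sub>\<infinity>i. \<Sum>\<^sub>\<infinity>n. a n i)"
    unfolding coleq'
    by (rule inf_eq[symmetric], rule summable_comparison_test'[OF colsum, of 0])
       (simp add: summable_norm[OF col])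
  also have "\<dots> = (\<Sum>\<^sub>\<infinity>n. \<Sum>\<^sub>\<infinity>i. a n i)"
    by (rule infsum_swap_banach[symmetric, OF sm])
  also have "\<dots> = (\<Sum>n. \<Sum>i\<le>n. a n i)"
    unfolding roweq'
    by (rule inf_eq, rule summable_comparison_test'[OF total, of 0]) (simp add: norm_sum)
  finally show "(\<Sum>i. \<Sum>n. a n i) = (\<Sum>n. \<Sum>i\<le>n. a n i)" .
qed

section \<open>The power series space\<close>

lemma power_series_space_summable:
  assumes "x \<in> power_series_space \<alpha>" "1 \<le> k"
  shows "summable (\<lambda>n. norm (x n) * exp (real k * \<alpha> n))"
  using assms by (auto simp: power_series_space_def)

lemma power_series_space_lincomb:
  fixes x y :: "nat \<Rightarrow> 'a::{real_normed_field, banach}"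
  assumes x: "x \<in> power_series_space \<alpha>" and y: "y \<in> power_series_space \<alpha>"
  shows "(\<lambda>n. a * x n + b * y n) \<in> power_series_space \<alpha>"
  unfolding power_series_space_def
proof (intro CollectI allI impI)
  fix k :: nat assume k: "1 \<le> k"
  have s: "summable (\<lambda>n. norm a * (norm (x n) * exp (real k * \<alpha> n))
      + norm b * (norm (y n) * exp (real k * \<alpha> n)))"
    by (intro summable_add summable_mult power_series_space_summable[OF _ k] x y)
  show "summable (\<lambda>n. norm (a * x n + b * y n) * exp (real k * \<alpha> n))"
  proof (rule summable_comparison_test'[OF s, of 0])
    fix n
    have "norm (a * x n + b * y n) \<le> norm a * norm (x n) + norm b * norm (y n)"
      by (metis norm_triangle_ineq norm_mult)
    then have "norm (a * x n + b * y n) * exp (real k * \<alpha> n)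
        \<le> (norm a * norm (x n) + norm b * norm (y n)) * exp (real k * \<alpha> n)"
      by (rule mult_right_mono) simp
    then show "norm (norm (a * x n + b * y n) * exp (real k * \<alpha> n))
        \<le> norm a * (norm (x n) * exp (real k * \<alpha> n)) + norm b * (norm (y n) * exp (real k * \<alpha> n))"
      by (simp add: algebra_simps)
  qed
qed

lemma power_series_space_sum:
  fixes y :: "nat \<Rightarrow> nat \<Rightarrow> 'a::{real_normed_field, banach}"
  assumes "\<And>i. y i \<in> power_series_space \<alpha>"
  shows "(\<lambda>n. \<Sum>i<N. f i * y i n) \<in> power_series_space \<alpha>"
proof (induction N)
  case 0
  show ?case by (simp add: power_series_space_def)
next
  case (Suc N)
  show ?case
    using power_series_space_lincomb[OF Suc assms[of N], of 1 "f N"] by simp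
qed

lemma unit_seq_sums:
  "(\<lambda>i. norm (unit_seq n i :: 'a::{real_normed_field, banach}) * exp (real k * \<alpha> i))
     sums exp (real k * \<alpha> n)"
proof -
  have "(\<lambda>i. norm (unit_seq n i :: 'a) * exp (real k * \<alpha> i))
      = (\<lambda>i. if i = n then exp (real k * \<alpha> i) else 0)"
    by (auto simp: unit_seq_def)
  then show ?thesis
    using sums_single[of n "\<lambda>i. exp (real k * \<alpha> i)"] by simp
qed

lemma unit_seq_in_power_series_space: "unit_seq n \<in> power_series_space \<alpha>"
  using unit_seq_sums by (auto simp: power_series_space_def sums_iff)

lemma psnorm_unit_seq:
  "psnorm \<alpha> k (unit_seq n :: nat \<Rightarrow> 'a::{real_normed_field, banach}) = exp (real k * \<alpha> n)"
  unfolding psnorm_def using unit_seq_sums[where 'a = 'a] by (simp add: sums_iff)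

lemma sum_le_psnorm:
  assumes "x \<in> power_series_space \<alpha>" "1 \<le> k" "finite A"
  shows "(\<Sum>n\<in>A. norm (x n) * exp (real k * \<alpha> n)) \<le> psnorm \<alpha> k x"
  unfolding psnorm_def
  by (rule sum_le_suminf[OF power_series_space_summable]) (use assms in auto)

lemma coordinate_le_psnorm:
  assumes "x \<in> power_series_space \<alpha>" "1 \<le> k"
  shows "norm (x n) * exp (real k * \<alpha> n) \<le> psnorm \<alpha> k x"
  using sum_le_psnorm[OF assms, of "{n}"] by simp

lemma psnorm_nonneg:
  assumes "x \<in> power_series_space \<alpha>" "1 \<le> k"
  shows "0 \<le> psnorm \<alpha> k x"
  using sum_le_psnorm[OF assms, of "{}"] by simp

section \<open>What nuclearity says about the exponents\<close>

text \<open>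
  A trace argument. Let \<open>x = \<Sum>i. f i x * y i\<close> be a nuclear representation of the map from seminorm
  \<open>q\<close> to seminorm \<open>1\<close>. Comparing the \<open>n\<close>-th coordinates at \<open>x = e n\<close> gives
  \<open>1 \<le> \<Sum>i. c i * exp (q * \<alpha> n) * norm (y i n)\<close>. After multiplication by
  \<open>exp ((1 - q) * \<alpha> n)\<close> and summation over \<open>n\<close>, the right-hand side is at most
  \<open>\<Sum>i. c i * psnorm \<alpha> 1 (y i)\<close>, hence \<open>\<Sum>n. exp (- (q - 1) * \<alpha> n)\<close> is finite. Its terms are decreasing, so
  the first \<open>n + 1\<close> of them add up to at least \<open>n + 1\<close> times the last one.
\<close>

lemma nuclear_imp_exponential_growth:
  fixes \<alpha> :: "nat \<Rightarrow> real"
  assumes nonneg: "\<And>n. 0 \<le> \<alpha> n" and incr: "incseq \<alpha>"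
    and nuclear: "nuclear_space (power_series_space \<alpha> :: (nat \<Rightarrow> 'a::{real_normed_field, banach}) set)
      (psnorm \<alpha>)"
  shows "\<exists>M\<ge>1. \<exists>r::nat. \<forall>n. real n + 1 \<le> M * exp (real r * \<alpha> n)"
proof -
  let ?E = "power_series_space \<alpha> :: (nat \<Rightarrow> 'a) set"
  obtain q and f :: "nat \<Rightarrow> (nat \<Rightarrow> 'a) \<Rightarrow> 'a" and c :: "nat \<Rightarrow> real" and y :: "nat \<Rightarrow> nat \<Rightarrow> 'a"
    where q: "1 \<le> q"
      and c0: "\<And>i. 0 \<le> c i" and f: "\<And>i x. x \<in> ?E \<Longrightarrow> norm (f i x) \<le> c i * psnorm \<alpha> q x"
      and y: "\<And>i. y i \<in> ?E" and sm: "summable (\<lambda>i. c i * psnorm \<alpha> 1 (y i))"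
      and lim: "\<And>x. x \<in> ?E \<Longrightarrow>
        (\<lambda>N. psnorm \<alpha> 1 (\<lambda>n. x n - (\<Sum>i<N. f i x * y i n))) \<longlonglongrightarrow> 0"
    using nuclear[unfolded nuclear_space_def, rule_format, OF order_refl]
    by (elim exE conjE) (rule that, auto)
  define K where "K = (\<Sum>i. c i * psnorm \<alpha> 1 (y i))"
  have coord: "(\<lambda>i. f i (unit_seq n) * y i n) sums 1" for n
  proof -
    let ?e = "unit_seq n :: nat \<Rightarrow> 'a"
    let ?d = "\<lambda>N m. ?e m - (\<Sum>i<N. f i ?e * y i m)"
    have e: "?e \<in> ?E" by (rule unit_seq_in_power_series_space)
    have "?d N \<in> ?E" for N
      using power_series_space_lincomb[OF e power_series_space_sum[OF y, where N = N and f = "\<lambda>i. f i ?e"], of 1 "-1"]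
      by simp
    then have "norm (?d N n) * exp (real 1 * \<alpha> n) \<le> psnorm \<alpha> 1 (?d N)" for N
      by (rule coordinate_le_psnorm) simp
    moreover have "norm (?d N n) \<le> norm (?d N n) * exp (real 1 * \<alpha> n)" for N
      using nonneg[of n] by (simp add: mult_le_cancel_left1)
    ultimately have le: "norm (?d N n) \<le> psnorm \<alpha> 1 (?d N)" for N
      by (rule order_trans[rotated])
    have "(\<lambda>N. ?d N n) \<longlonglongrightarrow> 0"
      by (rule Lim_null_comparison[OF _ lim[OF e]]) (use le in simp)
    then have "(\<lambda>N. 1 - ?d N n) \<longlonglongrightarrow> 1 - 0"
      by (intro tendsto_diff tendsto_const)
    then show ?thesis
      by (simp add: sums_def unit_seq_def)
  qed
  have partial: "(\<Sum>n\<le>N. exp (- (real q - 1) * \<alpha> n)) \<le> K" for N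
  proof -
    have y_le: "c i * (norm (y i n) * exp (real 1 * \<alpha> n)) \<le> c i * psnorm \<alpha> 1 (y i)" for i n
      by (rule mult_left_mono[OF coordinate_le_psnorm[OF y] c0]) simp
    have s: "summable (\<lambda>i. c i * (norm (y i n) * exp (real 1 * \<alpha> n)))" for n
      by (rule summable_comparison_test'[OF sm, of 0]) (use y_le c0 in \<open>simp add: abs_mult\<close>)
    have one: "exp (- (real q - 1) * \<alpha> n) \<le> (\<Sum>i. c i * (norm (y i n) * exp (real 1 * \<alpha> n)))" for n
    proof -
      have bd: "norm (f i (unit_seq n) * y i n)
          \<le> exp ((real q - 1) * \<alpha> n) * (c i * (norm (y i n) * exp (real 1 * \<alpha> n)))" for i
      proof -
        have "norm (f i (unit_seq n)) \<le> c i * exp (real q * \<alpha> n)"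
          using f[OF unit_seq_in_power_series_space] psnorm_unit_seq[where 'a = 'a] by metis
        then have "norm (f i (unit_seq n)) * norm (y i n) \<le> c i * exp (real q * \<alpha> n) * norm (y i n)"
          by (rule mult_right_mono) simp
        also have "exp (real q * \<alpha> n) = exp ((real q - 1) * \<alpha> n) * exp (real 1 * \<alpha> n)"
          by (simp add: algebra_simps flip: exp_add)
        finally show ?thesis by (simp add: norm_mult mult_ac)
      qed
      have s': "summable (\<lambda>i. exp ((real q - 1) * \<alpha> n) * (c i * (norm (y i n) * exp (real 1 * \<alpha> n))))"
        by (rule summable_mult[OF s])
      have sn: "summable (\<lambda>i. norm (f i (unit_seq n) * y i n))"
        by (rule summable_comparison_test'[OF s', of 0]) (use bd in simp)
      have "1 = norm (\<Sum>i. f i (unit_seq n) * y i n)"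
        using coord[of n] by (simp add: sums_iff)
      also have "\<dots> \<le> (\<Sum>i. norm (f i (unit_seq n) * y i n))"
        by (rule summable_norm[OF sn])
      also have "\<dots> \<le> (\<Sum>i. exp ((real q - 1) * \<alpha> n) * (c i * (norm (y i n) * exp (real 1 * \<alpha> n))))"
        by (rule suminf_le[OF bd sn s'])
      also have "\<dots> = exp ((real q - 1) * \<alpha> n) * (\<Sum>i. c i * (norm (y i n) * exp (real 1 * \<alpha> n)))"
        by (rule suminf_mult[OF s])
      finally have "exp (- ((real q - 1) * \<alpha> n)) * 1
          \<le> exp (- ((real q - 1) * \<alpha> n)) *
            (exp ((real q - 1) * \<alpha> n) * (\<Sum>i. c i * (norm (y i n) * exp (real 1 * \<alpha> n))))"
        by (intro mult_left_mono) auto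
      then show ?thesis
        by (simp only: mult.assoc[symmetric] exp_add[symmetric]) (simp add: algebra_simps)
    qed
    have "(\<Sum>n\<le>N. exp (- (real q - 1) * \<alpha> n))
        \<le> (\<Sum>n\<le>N. \<Sum>i. c i * (norm (y i n) * exp (real 1 * \<alpha> n)))"
      by (rule sum_mono) (rule one)
    also have "\<dots> = (\<Sum>i. \<Sum>n\<le>N. c i * (norm (y i n) * exp (real 1 * \<alpha> n)))"
      by (rule suminf_sum[symmetric]) (rule s)
    also have "\<dots> \<le> K"
      unfolding K_def
    proof (rule suminf_le[OF _ summable_sum sm])
      fix i
      show "(\<Sum>n\<le>N. c i * (norm (y i n) * exp (real 1 * \<alpha> n))) \<le> c i * psnorm \<alpha> 1 (y i)"
        unfolding sum_distrib_left[symmetric]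
        by (rule mult_left_mono[OF sum_le_psnorm[OF y] c0]) auto
    qed (rule s)
    finally show ?thesis .
  qed
  have growth: "real n + 1 \<le> max 1 K * exp (real (q - 1) * \<alpha> n)" for n
  proof -
    have "(\<Sum>m\<le>n. exp (- (real q - 1) * \<alpha> n)) \<le> (\<Sum>m\<le>n. exp (- (real q - 1) * \<alpha> m))"
      using q incseqD[OF incr] by (intro sum_mono) (simp add: mult_left_mono_neg)
    also have "\<dots> \<le> max 1 K" using partial[of n] by simp
    finally have "(real n + 1) * exp (- (real (q - 1) * \<alpha> n)) \<le> max 1 K"
      using q by (simp add: of_nat_diff algebra_simps)
    then show ?thesis
      by (simp add: exp_minus divide_simps)
  qed
  then show ?thesis
    by (intro exI[of _ "max 1 K"] conjI exI[of _ "q - 1"]) auto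
qed

section \<open>Dual convolution operators\<close>

lemma dual_conv_unit_apply: "dual_conv_unit \<phi> n i = (if i \<le> n then \<phi> (n - i) else 0)"
proof -
  have "dual_conv_unit \<phi> n i = (\<Sum>j\<le>n. if i = j then \<phi> (n - j) else 0)"
    unfolding dual_conv_unit_def unit_seq_def by (rule sum.cong) auto
  then show ?thesis by simp
qed

lemma sum_dual_conv_unit:
  "(\<Sum>m\<le>n. dual_conv_unit \<phi> n m * dual_conv_unit \<psi> m i) = dual_conv_unit (seq_conv \<psi> \<phi>) n i"
proof (cases "i \<le> n")
  case True
  have "(\<Sum>m\<le>n. dual_conv_unit \<phi> n m * dual_conv_unit \<psi> m i)
      = (\<Sum>m\<in>{i..n}. \<phi> (n - m) * \<psi> (m - i))"
    by (rule sum.mono_neutral_cong_right) (auto simp: dual_conv_unit_apply)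
  also have "\<dots> = (\<Sum>j\<le>n - i. \<psi> j * \<phi> (n - i - j))"
    by (rule sum.reindex_bij_witness[of _ "\<lambda>j. j + i" "\<lambda>m. m - i"]) (use True in auto)
  finally show ?thesis
    using True by (simp add: dual_conv_unit_apply seq_conv_def)
next
  case False
  then have "(\<Sum>m\<le>n. dual_conv_unit \<phi> n m * dual_conv_unit \<psi> m i) = 0"
    by (intro sum.neutral) (auto simp: dual_conv_unit_apply)
  then show ?thesis using False by (simp add: dual_conv_unit_apply)
qed

text \<open>The symbol \<open>unit_seq 0\<close> is the neutral element of convolution.\<close>

lemma dual_conv_identity: "dual_conv (unit_seq 0) x = x"
proof
  fix i
  have "(\<lambda>n. x n * dual_conv_unit (unit_seq 0) n i) = (\<lambda>n. if n = i then x n else 0)"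
    by (auto simp: dual_conv_unit_apply unit_seq_def)
  then show "dual_conv (unit_seq 0) x i = x i"
    unfolding dual_conv_def using sums_single[of i x] by (simp add: sums_iff)
qed

text \<open>
  The exponents of a nuclear space, with constants \<open>M\<close> and \<open>r\<close> in the role of the bound on
  \<open>ln n / \<alpha> n\<close>.
\<close>

locale nuclear_exponents =
  fixes \<alpha> :: "nat \<Rightarrow> real" and M :: real and r :: nat
  assumes nonneg: "0 \<le> \<alpha> n"
    and incr: "incseq \<alpha>"
    and M_ge_1: "1 \<le> M"
    and growth: "real n + 1 \<le> M * exp (real r * \<alpha> n)"
begin

lemma weight_mono: "m \<le> n \<Longrightarrow> exp (real q * \<alpha> m) \<le> exp (real q * \<alpha> n)"
  using incseqD[OF incr] by (simp add: mult_left_mono)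

lemma symbol_bound_nonneg:
  assumes "\<And>n. norm (\<phi> n) \<le> B * exp (real q * \<alpha> n)"
  shows "0 \<le> B"
proof -
  have "0 \<le> B * exp (real q * \<alpha> 0)"
    using assms[of 0] norm_ge_zero order_trans by blast
  then show ?thesis by (simp add: zero_le_mult_iff)
qed

lemma norm_dual_conv_unit_le:
  assumes "\<And>n. norm (\<phi> n) \<le> B * exp (real q * \<alpha> n)"
  shows "norm (dual_conv_unit \<phi> n i) \<le> B * exp (real q * \<alpha> n)"
proof (cases "i \<le> n")
  case True
  have "norm (\<phi> (n - i)) \<le> B * exp (real q * \<alpha> (n - i))" by (rule assms)
  also have "\<dots> \<le> B * exp (real q * \<alpha> n)"
    by (intro mult_left_mono weight_mono symbol_bound_nonneg[OF assms]) auto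
  finally show ?thesis using True by (simp add: dual_conv_unit_apply)
next
  case False
  then show ?thesis using symbol_bound_nonneg[OF assms] by (simp add: dual_conv_unit_apply)
qed

text \<open>
  The majorant in \<open>triangular_sum_swap\<close>: the row length \<open>n + 1\<close> turns into a shift of the seminorm
  index by \<open>r\<close>.
\<close>

lemma row_majorant:
  assumes x: "x \<in> power_series_space \<alpha>" and s: "1 \<le> s" and B: "0 \<le> B"
  shows "summable (\<lambda>n. (real n + 1) * (norm (x n) * (B * exp (real s * \<alpha> n))))"
    and "(\<Sum>n. (real n + 1) * (norm (x n) * (B * exp (real s * \<alpha> n)))) \<le> B * M * psnorm \<alpha> (s + r) x"
proof -
  have le: "(real n + 1) * (norm (x n) * (B * exp (real s * \<alpha> n)))
      \<le> B * M * (norm (x n) * exp (real (s + r) * \<alpha> n))" for n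
  proof -
    have "(real n + 1) * (norm (x n) * (B * exp (real s * \<alpha> n)))
        \<le> (M * exp (real r * \<alpha> n)) * (norm (x n) * (B * exp (real s * \<alpha> n)))"
      by (rule mult_right_mono[OF growth]) (use B in simp)
    also have "\<dots> = B * M * (norm (x n) * exp (real (s + r) * \<alpha> n))"
      by (simp add: algebra_simps exp_add)
    finally show ?thesis .
  qed
  have sm0: "summable (\<lambda>n. norm (x n) * exp (real (s + r) * \<alpha> n))"
    by (rule power_series_space_summable[OF x]) (use s in simp)
  then have sm: "summable (\<lambda>n. B * M * (norm (x n) * exp (real (s + r) * \<alpha> n)))"
    by (rule summable_mult)
  show *: "summable (\<lambda>n. (real n + 1) * (norm (x n) * (B * exp (real s * \<alpha> n))))"
    by (rule summable_comparison_test'[OF sm, of 0]) (use le B in \<open>simp add: abs_mult\<close>)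
  show "(\<Sum>n. (real n + 1) * (norm (x n) * (B * exp (real s * \<alpha> n)))) \<le> B * M * psnorm \<alpha> (s + r) x"
    using suminf_le[OF le * sm] unfolding psnorm_def suminf_mult[OF sm0] .
qed

text \<open>
  Inside the double series, the weight \<open>exp (p * \<alpha> i)\<close> of the \<open>i\<close>-th coordinate is at most
  \<open>exp (p * \<alpha> n)\<close>, as only the terms with \<open>i \<le> n\<close> are nonzero. So \<open>row_majorant\<close> with
  \<open>s = p + q\<close> gives both the membership and the bound.
\<close>

lemma
  fixes \<phi> :: "nat \<Rightarrow> 'a::{real_normed_field, banach}"
  assumes \<phi>: "\<And>n. norm (\<phi> n) \<le> B * exp (real q * \<alpha> n)"
    and x: "x \<in> power_series_space \<alpha>"
  shows dual_conv_in_space: "dual_conv \<phi> x \<in> power_series_space \<alpha>"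
    and dual_conv_bound: "\<And>p. 1 \<le> p \<Longrightarrow> psnorm \<alpha> p (dual_conv \<phi> x) \<le> B * M * psnorm \<alpha> (p + q + r) x"
    and dual_conv_summable: "\<And>i. summable (\<lambda>n. norm (x n * dual_conv_unit \<phi> n i))"
proof -
  define a where "a = (\<lambda>p n i. x n * dual_conv_unit \<phi> n i * of_real (exp (real p * \<alpha> i)))"
  note B = symbol_bound_nonneg[OF \<phi>]
  have tri: "a p n i = 0" if "n < i" for p n i
    using that by (simp add: a_def dual_conv_unit_apply)
  have bd: "norm (a p n i) \<le> norm (x n) * (B * exp (real (p + q) * \<alpha> n))" if "i \<le> n" for p n i
  proof -
    have "norm (a p n i) = norm (x n) * (norm (dual_conv_unit \<phi> n i) * exp (real p * \<alpha> i))"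
      by (simp add: a_def norm_mult)
    also have "\<dots> \<le> norm (x n) * ((B * exp (real q * \<alpha> n)) * exp (real p * \<alpha> n))"
      by (intro mult_left_mono mult_mono norm_dual_conv_unit_le \<phi> weight_mono that) (use B in auto)
    finally show ?thesis by (simp add: algebra_simps exp_add)
  qed
  have sm: "summable (\<lambda>n. norm (a p n i))" if "1 \<le> p" for p i
    by (rule triangular_sum_swap(1)[OF tri bd row_majorant(1)[OF x _ B]]) (use that in auto)
  have scaled: "(\<Sum>n. norm (a p n i)) = (\<Sum>n. norm (x n * dual_conv_unit \<phi> n i)) * exp (real p * \<alpha> i)"
    if s: "summable (\<lambda>n. norm (x n * dual_conv_unit \<phi> n i))" for p i
    unfolding a_def norm_mult[of _ "of_real _"] using suminf_mult2[OF s] by simp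
  show s: "summable (\<lambda>n. norm (x n * dual_conv_unit \<phi> n i))" for i
  proof -
    have "summable (\<lambda>n. norm (x n * dual_conv_unit \<phi> n i) * exp (real 1 * \<alpha> i))"
      using sm[of 1 i] unfolding a_def norm_mult[of _ "of_real _"] by simp
    then show ?thesis
      by (simp add: mult.commute[of _ "exp _"] del: norm_mult)
  qed
  have le: "norm (dual_conv \<phi> x i) * exp (real p * \<alpha> i) \<le> (\<Sum>n. norm (a p n i))" if "1 \<le> p" for p i
    unfolding scaled[OF s] dual_conv_def
    by (rule mult_right_mono[OF summable_norm[OF s]]) simp
  have cols: "summable (\<lambda>i. \<Sum>n. norm (a p n i))" if "1 \<le> p" for p
    by (rule triangular_sum_swap(2)[OF tri bd row_majorant(1)[OF x _ B]]) (use that in auto)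
  have sums: "summable (\<lambda>i. norm (dual_conv \<phi> x i) * exp (real p * \<alpha> i))" if "1 \<le> p" for p
    by (rule summable_comparison_test'[OF cols[OF that], of 0]) (use le[OF that] in simp)
  then show "dual_conv \<phi> x \<in> power_series_space \<alpha>"
    by (simp add: power_series_space_def)
  fix p :: nat assume p: "1 \<le> p"
  have "psnorm \<alpha> p (dual_conv \<phi> x) \<le> (\<Sum>i. \<Sum>n. norm (a p n i))"
    unfolding psnorm_def by (rule suminf_le[OF le[OF p] sums[OF p] cols[OF p]])
  also have "\<dots> \<le> (\<Sum>n. (real n + 1) * (norm (x n) * (B * exp (real (p + q) * \<alpha> n))))"
    by (rule triangular_sum_swap(3)[OF tri bd row_majorant(1)[OF x _ B]]) (use p in auto)
  also have "\<dots> \<le> B * M * psnorm \<alpha> (p + q + r) x"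
    by (rule row_majorant(2)[OF x _ B]) (use p in simp)
  finally show "psnorm \<alpha> p (dual_conv \<phi> x) \<le> B * M * psnorm \<alpha> (p + q + r) x" .
qed

lemma dual_conv_linear:
  fixes \<phi> :: "nat \<Rightarrow> 'a::{real_normed_field, banach}"
  assumes \<phi>: "\<And>n. norm (\<phi> n) \<le> B * exp (real q * \<alpha> n)"
    and x: "x \<in> power_series_space \<alpha>" and y: "y \<in> power_series_space \<alpha>"
  shows "dual_conv \<phi> (\<lambda>n. a * x n + b * y n) = (\<lambda>n. a * dual_conv \<phi> x n + b * dual_conv \<phi> y n)"
proof
  fix i
  have "(\<lambda>n. a * (x n * dual_conv_unit \<phi> n i) + b * (y n * dual_conv_unit \<phi> n i))
      sums (a * dual_conv \<phi> x i + b * dual_conv \<phi> y i)"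
    unfolding dual_conv_def
    by (intro sums_add sums_mult summable_sums
        summable_norm_cancel[OF dual_conv_summable[OF \<phi> x]]
        summable_norm_cancel[OF dual_conv_summable[OF \<phi> y]])
  then show "dual_conv \<phi> (\<lambda>n. a * x n + b * y n) i = a * dual_conv \<phi> x i + b * dual_conv \<phi> y i"
    by (simp add: dual_conv_def sums_iff algebra_simps)
qed

lemma continuous_linear_operator_dual_conv:
  fixes \<phi> :: "nat \<Rightarrow> 'a::{real_normed_field, banach}"
  assumes \<phi>: "\<And>n. norm (\<phi> n) \<le> B * exp (real q * \<alpha> n)"
  shows "continuous_linear_operator (power_series_space \<alpha>) (psnorm \<alpha>) (dual_conv \<phi>)"
  unfolding continuous_linear_operator_def
proof (intro conjI ballI allI impI)
  fix p :: nat assume p: "1 \<le> p"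
  show "\<exists>q\<ge>1. \<exists>C. \<forall>x\<in>power_series_space \<alpha>. psnorm \<alpha> p (dual_conv \<phi> x) \<le> C * psnorm \<alpha> q x"
    using dual_conv_bound[OF \<phi> _ p] p by (intro exI[of _ "p + q + r"] exI[of _ "B * M"]) auto
qed (use dual_conv_in_space[OF \<phi>] dual_conv_linear[OF \<phi>] in auto)

section \<open>Composition is convolution of symbols\<close>

text \<open>
  On unit vectors this is the identity \<open>sum_dual_conv_unit\<close>; the exchange of summations extends it to
  the whole space.
\<close>

lemma dual_conv_dual_conv:
  fixes \<phi> \<psi> :: "nat \<Rightarrow> 'a::{real_normed_field, banach}"
  assumes \<phi>: "\<And>n. norm (\<phi> n) \<le> B * exp (real q * \<alpha> n)"
    and \<psi>: "\<And>n. norm (\<psi> n) \<le> B' * exp (real q' * \<alpha> n)"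
    and q: "1 \<le> q"
    and x: "x \<in> power_series_space \<alpha>"
  shows "dual_conv \<psi> (dual_conv \<phi> x) = dual_conv (seq_conv \<psi> \<phi>) x"
proof
  fix i
  define a where "a = (\<lambda>n m. x n * dual_conv_unit \<phi> n m * dual_conv_unit \<psi> m i)"
  note B = symbol_bound_nonneg[OF \<phi>] and B' = symbol_bound_nonneg[OF \<psi>]
  have tri: "a n m = 0" if "n < m" for n m
    using that by (simp add: a_def dual_conv_unit_apply)
  have bd: "norm (a n m) \<le> norm (x n) * (B * B' * exp (real (q + q') * \<alpha> n))" if "m \<le> n" for n m
  proof -
    have "norm (dual_conv_unit \<psi> m i) \<le> B' * exp (real q' * \<alpha> m)"
      by (rule norm_dual_conv_unit_le[OF \<psi>])
    also have "\<dots> \<le> B' * exp (real q' * \<alpha> n)"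
      by (intro mult_left_mono weight_mono that B')
    finally have "norm (x n) * (norm (dual_conv_unit \<phi> n m) * norm (dual_conv_unit \<psi> m i))
        \<le> norm (x n) * ((B * exp (real q * \<alpha> n)) * (B' * exp (real q' * \<alpha> n)))"
      by (intro mult_left_mono mult_mono norm_dual_conv_unit_le \<phi>) (use B in auto)
    then show ?thesis
      by (simp add: a_def norm_mult algebra_simps exp_add)
  qed
  have "summable (\<lambda>n. x n * dual_conv_unit \<phi> n m)" for m
    by (rule summable_norm_cancel[OF dual_conv_summable[OF \<phi> x]])
  then have "(\<Sum>n. x n * dual_conv_unit \<phi> n m) * dual_conv_unit \<psi> m i = (\<Sum>n. a n m)" for m
    unfolding a_def by (rule suminf_mult2)
  then have "dual_conv \<psi> (dual_conv \<phi> x) i = (\<Sum>m. \<Sum>n. a n m)"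
    by (simp add: dual_conv_def)
  also have "\<dots> = (\<Sum>n. \<Sum>m\<le>n. a n m)"
    by (rule triangular_sum_swap(4)[OF tri bd row_majorant(1)[OF x]]) (use q B B' in auto)
  also have "\<dots> = dual_conv (seq_conv \<psi> \<phi>) x i"
    by (simp add: a_def dual_conv_def mult.assoc sum_dual_conv_unit flip: sum_distrib_left)
  finally show "dual_conv \<psi> (dual_conv \<phi> x) i = dual_conv (seq_conv \<psi> \<phi>) x i" .
qed

text \<open>
  The dual is an algebra under convolution, so the composition rule applies to all iterates: a
  convolution has \<open>n + 1\<close> summands, and again the growth condition absorbs this number.
\<close>

lemma seq_conv_bound:
  fixes \<phi> \<psi> :: "nat \<Rightarrow> 'a::{real_normed_field, banach}"
  assumes \<phi>: "\<And>n. norm (\<phi> n) \<le> B * exp (real q * \<alpha> n)"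
    and \<psi>: "\<And>n. norm (\<psi> n) \<le> B' * exp (real q' * \<alpha> n)"
  shows "norm (seq_conv \<psi> \<phi> n) \<le> M * B' * B * exp (real (r + q' + q) * \<alpha> n)"
proof -
  note B = symbol_bound_nonneg[OF \<phi>] and B' = symbol_bound_nonneg[OF \<psi>]
  have "norm (\<psi> i * \<phi> (n - i)) \<le> (B' * exp (real q' * \<alpha> n)) * (B * exp (real q * \<alpha> n))"
    if "i \<le> n" for i
  proof -
    have "norm (\<psi> i) \<le> B' * exp (real q' * \<alpha> n)"
      by (rule order_trans[OF \<psi>]) (intro mult_left_mono weight_mono that B')
    moreover have "norm (\<phi> (n - i)) \<le> B * exp (real q * \<alpha> n)"
      by (rule order_trans[OF \<phi>]) (intro mult_left_mono weight_mono B, simp)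
    ultimately show ?thesis
      unfolding norm_mult by (intro mult_mono) (use B' in auto)
  qed
  then have "norm (seq_conv \<psi> \<phi> n) \<le> (\<Sum>i\<le>n. (B' * exp (real q' * \<alpha> n)) * (B * exp (real q * \<alpha> n)))"
    unfolding seq_conv_def by (intro sum_norm_le) auto
  also have "\<dots> = (real n + 1) * ((B' * exp (real q' * \<alpha> n)) * (B * exp (real q * \<alpha> n)))"
    by simp
  also have "\<dots> \<le> (M * exp (real r * \<alpha> n)) * ((B' * exp (real q' * \<alpha> n)) * (B * exp (real q * \<alpha> n)))"
    by (rule mult_right_mono[OF growth]) (use B B' in simp)
  finally show ?thesis by (simp add: algebra_simps exp_add)
qed

lemma conv_power_in_dual:
  assumes "\<beta> \<in> power_series_dual \<alpha>"
  shows "\<exists>q\<ge>1. \<exists>B. \<forall>n. norm (conv_power \<beta> k n) \<le> B * exp (real q * \<alpha> n)"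
proof (induction k)
  case 0
  have "norm (conv_power \<beta> 0 n) \<le> 1 * exp (real 1 * \<alpha> n)" for n
    using nonneg by (simp add: unit_seq_def)
  then show ?case by blast
next
  case (Suc k)
  then obtain q B where q: "1 \<le> q" and B: "\<And>n. norm (conv_power \<beta> k n) \<le> B * exp (real q * \<alpha> n)"
    by blast
  from assms obtain m C where C: "\<And>n. norm (\<beta> n) \<le> C * exp (real (m::nat) * \<alpha> n)"
    unfolding power_series_dual_def by blast
  from seq_conv_bound[OF B C]
  have "norm (conv_power \<beta> (Suc k) n) \<le> M * C * B * exp (real (r + m + q) * \<alpha> n)" for n
    by simp
  then show ?case using q by (intro exI[of _ "r + m + q"] conjI exI[of _ "M * C * B"]) auto
qed

lemma funpow_dual_conv:
  assumes \<beta>: "\<beta> \<in> power_series_dual \<alpha>" and x: "x \<in> power_series_space \<alpha>"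
  shows "(dual_conv \<beta> ^^ k) x = dual_conv (conv_power \<beta> k) x"
proof (induction k)
  case 0
  show ?case by (simp add: dual_conv_identity)
next
  case (Suc k)
  obtain q B where q: "1 \<le> q" and B: "\<And>n. norm (conv_power \<beta> k n) \<le> B * exp (real q * \<alpha> n)"
    using conv_power_in_dual[OF \<beta>] by blast
  from \<beta> obtain m C where C: "\<And>n. norm (\<beta> n) \<le> C * exp (real (m::nat) * \<alpha> n)"
    unfolding power_series_dual_def by blast
  show ?case
    using dual_conv_dual_conv[OF B C q x] Suc by simp
qed

section \<open>Iterates and convolution powers\<close>

text \<open>The entry with index \<open>0\<close> of the \<open>k\<close>-th iterate at \<open>e n\<close> is \<open>conv_power \<beta> k n\<close>.\<close>

lemma conv_power_le_of_iterate:
  fixes \<beta> :: "nat \<Rightarrow> 'a::{real_normed_field, banach}"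
  assumes \<beta>: "\<beta> \<in> power_series_dual \<alpha>" and p: "1 \<le> p"
    and bound: "\<And>x. x \<in> power_series_space \<alpha> \<Longrightarrow>
      psnorm \<alpha> p ((dual_conv \<beta> ^^ k) x) \<le> d * psnorm \<alpha> q x"
  shows "norm (conv_power \<beta> k n) \<le> d * exp (real q * \<alpha> n)"
proof -
  let ?e = "unit_seq n :: nat \<Rightarrow> 'a"
  have e: "?e \<in> power_series_space \<alpha>" by (rule unit_seq_in_power_series_space)
  obtain q' B where B: "\<And>n. norm (conv_power \<beta> k n) \<le> B * exp (real q' * \<alpha> n)"
    using conv_power_in_dual[OF \<beta>] by blast
  let ?y = "dual_conv (conv_power \<beta> k) ?e"
  have "norm (conv_power \<beta> k n) = norm (?y 0)"
    by (simp add: dual_conv_unit_seq dual_conv_unit_apply)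
  also have "\<dots> \<le> norm (?y 0) * exp (real p * \<alpha> 0)"
    using nonneg[of 0] by (simp add: mult_le_cancel_left1)
  also have "\<dots> \<le> psnorm \<alpha> p ?y"
    by (rule coordinate_le_psnorm[OF dual_conv_in_space[OF B e] p])
  also have "\<dots> \<le> d * psnorm \<alpha> q ?e"
    using bound[OF e] funpow_dual_conv[OF \<beta> e] by simp
  finally show ?thesis by (simp add: psnorm_unit_seq)
qed

lemma iterate_le_of_conv_power:
  assumes \<beta>: "\<beta> \<in> power_series_dual \<alpha>" and p: "1 \<le> p"
    and bound: "\<And>n. norm (conv_power \<beta> k n) \<le> d * exp (real q * \<alpha> n)"
    and x: "x \<in> power_series_space \<alpha>"
  shows "psnorm \<alpha> p ((dual_conv \<beta> ^^ k) x) \<le> d * M * psnorm \<alpha> (p + q + r) x"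
  using dual_conv_bound[OF bound x p] funpow_dual_conv[OF \<beta> x] by simp

lemma m_topologizable_dual_conv_iff:
  assumes \<beta>: "\<beta> \<in> power_series_dual \<alpha>"
  shows "m_topologizable (power_series_space \<alpha>) (psnorm \<alpha>) (dual_conv \<beta>) \<longleftrightarrow>
    (\<exists>q\<ge>1. \<exists>D>0. \<forall>k\<ge>1. \<forall>n. norm (conv_power \<beta> k n) \<le> D ^ k * exp (real q * \<alpha> n))"
    (is "?top \<longleftrightarrow> ?conv")
proof
  assume ?top
  then obtain q C where q: "1 \<le> q" and C: "1 \<le> C"
    and bd: "\<And>k x. 1 \<le> k \<Longrightarrow> x \<in> power_series_space \<alpha> \<Longrightarrow>
      psnorm \<alpha> 1 ((dual_conv \<beta> ^^ k) x) \<le> C ^ k * psnorm \<alpha> q x"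
    unfolding m_topologizable_def by blast
  have "norm (conv_power \<beta> k n) \<le> C ^ k * exp (real q * \<alpha> n)" if "1 \<le> k" for k n
    by (rule conv_power_le_of_iterate[OF \<beta> order_refl bd[OF that]])
  with q C show ?conv by (intro exI[of _ q] conjI exI[of _ C]) auto
next
  assume ?conv
  then obtain q D where D: "0 < D"
    and bd: "\<And>k n. 1 \<le> k \<Longrightarrow> norm (conv_power \<beta> k n) \<le> D ^ k * exp (real q * \<alpha> n)"
    by blast
  obtain m C where "\<And>n. norm (\<beta> n) \<le> C * exp (real (m::nat) * \<alpha> n)"
    using \<beta> unfolding power_series_dual_def by blast
  note cont = continuous_linear_operator_dual_conv[OF this]
  have iter: "psnorm \<alpha> p ((dual_conv \<beta> ^^ k) x) \<le> max 1 (D * M) ^ k * psnorm \<alpha> (p + q + r) x"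
    if p: "1 \<le> p" and k: "1 \<le> k" and x: "x \<in> power_series_space \<alpha>" for p k x
  proof -
    \<comment> \<open>For \<open>k \<ge> 1\<close> the factor \<open>M\<close> is at most \<open>M ^ k\<close> and joins the geometric bound.\<close>
    have "D ^ k * M \<le> D ^ k * M ^ k"
      using D M_ge_1 power_increasing[OF k M_ge_1] by simp
    also have "\<dots> \<le> max 1 (D * M) ^ k"
      using D M_ge_1 by (simp add: power_mono flip: power_mult_distrib)
    finally have "D ^ k * M * psnorm \<alpha> (p + q + r) x \<le> max 1 (D * M) ^ k * psnorm \<alpha> (p + q + r) x"
      by (rule mult_right_mono) (use p psnorm_nonneg[OF x] in simp)
    with iterate_le_of_conv_power[OF \<beta> p bd[OF k] x] show ?thesis by linarith
  qed
  show ?top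
    unfolding m_topologizable_def
  proof (intro conjI cont allI impI)
    fix p :: nat assume p: "1 \<le> p"
    then show "\<exists>q\<ge>1. \<exists>C\<ge>1. \<forall>k\<ge>1. \<forall>x\<in>power_series_space \<alpha>.
        psnorm \<alpha> p ((dual_conv \<beta> ^^ k) x) \<le> C ^ k * psnorm \<alpha> q x"
      using iter[OF p] by (intro exI[of _ "p + q + r"] conjI exI[of _ "max 1 (D * M)"]) auto
  qed
qed

lemma power_bounded_dual_conv_iff:
  assumes \<beta>: "\<beta> \<in> power_series_dual \<alpha>"
  shows "power_bounded (power_series_space \<alpha>) (psnorm \<alpha>) (dual_conv \<beta>) \<longleftrightarrow>
    (\<exists>q\<ge>1. \<exists>C\<ge>1. \<forall>k\<ge>1. \<forall>n. norm (conv_power \<beta> k n) \<le> C * exp (real q * \<alpha> n))"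
    (is "?pb \<longleftrightarrow> ?conv")
proof
  assume ?pb
  then obtain q C where q: "1 \<le> q" and C: "1 \<le> C"
    and bd: "\<And>k x. 1 \<le> k \<Longrightarrow> x \<in> power_series_space \<alpha> \<Longrightarrow>
      psnorm \<alpha> 1 ((dual_conv \<beta> ^^ k) x) \<le> C * psnorm \<alpha> q x"
    unfolding power_bounded_def by blast
  have "norm (conv_power \<beta> k n) \<le> C * exp (real q * \<alpha> n)" if "1 \<le> k" for k n
    by (rule conv_power_le_of_iterate[OF \<beta> order_refl bd[OF that]])
  with q C show ?conv by (intro exI[of _ q] conjI exI[of _ C]) auto
next
  assume ?conv
  then obtain q C where C: "1 \<le> C"
    and bd: "\<And>k n. 1 \<le> k \<Longrightarrow> norm (conv_power \<beta> k n) \<le> C * exp (real q * \<alpha> n)"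
    by blast
  obtain m C' where "\<And>n. norm (\<beta> n) \<le> C' * exp (real (m::nat) * \<alpha> n)"
    using \<beta> unfolding power_series_dual_def by blast
  note cont = continuous_linear_operator_dual_conv[OF this]
  have CM: "1 \<le> C * M" using mult_mono[OF C M_ge_1] C by simp
  show ?pb
    unfolding power_bounded_def
  proof (intro conjI cont allI impI)
    fix p :: nat assume p: "1 \<le> p"
    then show "\<exists>q\<ge>1. \<exists>C\<ge>1. \<forall>k\<ge>1. \<forall>x\<in>power_series_space \<alpha>.
        psnorm \<alpha> p ((dual_conv \<beta> ^^ k) x) \<le> C * psnorm \<alpha> q x"
      using iterate_le_of_conv_power[OF \<beta> p bd] CM
      by (intro exI[of _ "p + q + r"] conjI exI[of _ "C * M"]) auto
  qed
qed

end

theorem theorem5p2: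
  fixes \<alpha> :: "nat \<Rightarrow> real" and \<beta> :: "nat \<Rightarrow> 'a::{real_normed_field, banach}"
  assumes nonneg: "\<And>n. 0 \<le> \<alpha> n"
    and incr: "incseq \<alpha>"
    and lim: "filterlim \<alpha> at_top sequentially"
    and nuclear: "nuclear_space (power_series_space \<alpha> :: (nat \<Rightarrow> 'a) set) (psnorm \<alpha>)"
    and dual: "\<beta> \<in> power_series_dual \<alpha>"
  shows "(m_topologizable (power_series_space \<alpha>) (psnorm \<alpha>) (dual_conv \<beta>) \<longleftrightarrow>
           (\<forall>p\<ge>(1::nat). \<exists>q\<ge>(1::nat). \<exists>D>(0::real). \<forall>k\<ge>1. \<forall>n.
              norm (conv_power \<beta> k n) \<le> D ^ k * exp (real q * \<alpha> n))) \<and>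
         (power_bounded (power_series_space \<alpha>) (psnorm \<alpha>) (dual_conv \<beta>) \<longleftrightarrow>
           (\<forall>p\<ge>(1::nat). \<exists>q\<ge>(1::nat). \<exists>C\<ge>(1::real). \<forall>k\<ge>1. \<forall>n.
              norm (conv_power \<beta> k n) \<le> C * exp (real q * \<alpha> n)))"
proof -
  obtain M r where "1 \<le> M" "\<And>n. real n + 1 \<le> M * exp (real (r::nat) * \<alpha> n)"
    using nuclear_imp_exponential_growth[OF nonneg incr nuclear] by blast
  then interpret nuclear_exponents \<alpha> M r
    using nonneg incr by unfold_locales
  show ?thesis
    unfolding m_topologizable_dual_conv_iff[OF dual] power_bounded_dual_conv_iff[OF dual] by blast
qed

end
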